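(* Consider the left-invariant Lorentzian structure $g$ on $G=\mathrm{Aff}_+(\mathbb R)$ given by a matrix $A=\begin{pmatrix}a&b\\c&d\end{pmatrix}$, $|A|>0$, $a\ge0$, with sectional curvature $K=0$. Then the Lie algebra of Killing vector fields is $i(G)=\operatorname{span}(\widetilde X_1,\widetilde X_2,X_0)$, where $$X_0=\left(x+\mathsf g(y^2-1)\right)\partial_x+y(1-y)\,\partial_y .$$ The Lie brackets in this Lie algebra are $[\widetilde X_1,\widetilde X_2]=\widetilde X_1$, $[\widetilde X_1,X_0]=\widetilde X_1$, $[\widetilde X_2,X_0]=2\mathsf g\widetilde X_1-\widetilde X_2+X_0$. The Lie algebra $i(G)$ is isomorphic to the Lie algebra $\mathfrak{sh}(2)$ of the Lie group $\mathrm{SH}(2)$ of hyperbolic motions of the plane.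
   Context: $G=\mathrm{Aff}_+(\mathbb R)=\{(x,y)\in\mathbb R^2: y>0\}$ with product $(x_2,y_2)\cdot(x_1,y_1)=(x_2+y_2x_1,\,y_2y_1)$ and identity $\mathrm{Id}=(0,1)$; left-invariant frame $X_1=y\,\partial_x$, $X_2=y\,\partial_y$. A real matrix $A=\begin{pmatrix}a&b\\c&d\end{pmatrix}$ with $|A|=ad-bc>0$ determines the left-invariant Lorentzian form $g(u_1X_1+u_2X_2)=-(au_1+bu_2)^2+(cu_1+du_2)^2$. Standing assumption of the paper: $a\ge0$. Write $A^{-1}=\begin{pmatrix}\alpha&\beta\\ \gamma&\delta\end{pmatrix}$. The sectional curvature is $K=(c^2-a^2)/|A|^2=\gamma^2-\delta^2$. For $K=0$ put $s_1=\operatorname{sgn}\gamma$ and $\mathsf g=-\frac{\alpha+s_1\beta}{2\gamma}$ (a real constant, not the metric). A vector field $X$ on $G$ is Killing if $L_Xg=0$; $i(G)$ is the Lie algebra over $\mathbb R$ of Killing vector fields, with the usual bracket of vector fields (so that $[X_2,X_1]=X_1$). $\widetilde X_1=\partial_x$, $\widetilde X_2=x\,\partial_x+y\,\partial_y$. $\mathrm{SH}(2)$ is the three-dimensional group of motions of the plane generated by translations and hyperbolic rotations $e^{t(y\partial_x+x\partial_y)}$. *)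

theory Defs
  imports "HOL-Analysis.Analysis" "HOL-Library.Function_Algebras"
begin

section \<open>Functions into a vector space as a vector space\<close>

instantiation "fun" :: (type, scaleR) scaleR
begin
definition scaleR_fun_def: "scaleR c f = (\<lambda>x. c *\<^sub>R f x)"
instance ..
end

instance "fun" :: (type, real_vector) real_vector
  by standard (simp_all add: scaleR_fun_def plus_fun_def fun_eq_iff scaleR_add_right scaleR_add_left)


section \<open>The group of orientation-preserving affine maps of the line\<close>

definition G :: "(real \<times> real) set"
  where "G = {p. snd p > 0}"

definition G_mult :: "real \<times> real \<Rightarrow> real \<times> real \<Rightarrow> real \<times> real"
  where "G_mult q p = (fst q + snd q * fst p, snd q * snd p)"

text \<open>
  A vector field on the open half-plane \<open>G\<close> is a total function, normalised to vanish
  off \<open>G\<close>, so that fields agreeing on \<open>G\<close> are equal. Derivatives are only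
  ever evaluated at points of \<open>G\<close>, which is open.
\<close>

type_synonym field = "real \<times> real \<Rightarrow> real \<times> real"

type_synonym metric = "real \<times> real \<Rightarrow> real \<times> real \<Rightarrow> real \<times> real \<Rightarrow> real"

definition on_G :: "field \<Rightarrow> field"
  where "on_G X = (\<lambda>p. if p \<in> G then X p else 0)"

definition X1 :: field
  where "X1 = on_G (\<lambda>(x, y). (y, 0))"

definition X2 :: field
  where "X2 = on_G (\<lambda>(x, y). (0, y))"

text \<open>\<open>C\<^sup>k\<close> maps on an open set \<open>S\<close>.\<close>

primrec Ck_on :: "nat \<Rightarrow> 'a::real_normed_vector set \<Rightarrow> ('a \<Rightarrow> 'b::real_normed_vector) \<Rightarrow> bool"
  where
    "Ck_on 0 S f \<longleftrightarrow> continuous_on S f"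
  | "Ck_on (Suc k) S f \<longleftrightarrow> (\<forall>x\<in>S. f differentiable (at x)) \<and>
       (\<forall>v. Ck_on k S (\<lambda>x. frechet_derivative f (at x) v))"

definition smooth_field :: "field \<Rightarrow> bool"
  where "smooth_field X \<longleftrightarrow> (\<forall>k. Ck_on k G X) \<and> (\<forall>p. p \<notin> G \<longrightarrow> X p = 0)"

definition deriv_along :: "field \<Rightarrow> (real \<times> real \<Rightarrow> 'b::real_normed_vector) \<Rightarrow> real \<times> real \<Rightarrow> 'b"
  where "deriv_along X f p = frechet_derivative f (at p) (X p)"

definition bracket :: "field \<Rightarrow> field \<Rightarrow> field"
  where "bracket X Y = on_G (\<lambda>p. deriv_along X Y p - deriv_along Y X p)"


section \<open>The left-invariant Lorentzian metric\<close>

text \<open>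
  The coordinates of a tangent vector \<open>v\<close> at \<open>p\<close> in the frame \<open>X1\<close>, \<open>X2\<close> are
  \<open>u\<^sub>i = v\<^sub>i / snd p\<close>. The symmetric bilinear form below is the polarisation of
  \<open>- (a u\<^sub>1 + b u\<^sub>2)\<^sup>2 + (c u\<^sub>1 + d u\<^sub>2)\<^sup>2\<close>, where \<open>A\<close> has rows \<open>(a, b)\<close> and \<open>(c, d)\<close>.
\<close>

definition frame_coords :: "real \<times> real \<Rightarrow> real \<times> real \<Rightarrow> real ^ 2"
  where "frame_coords p v = vector [fst v / snd p, snd v / snd p]"

definition lorentz_metric :: "real ^ 2 ^ 2 \<Rightarrow> metric"
  where "lorentz_metric A p v w =
    - ((A *v frame_coords p v) $ 1) * ((A *v frame_coords p w) $ 1)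
    + ((A *v frame_coords p v) $ 2) * ((A *v frame_coords p w) $ 2)"

lemma frame_left_invariant:
  assumes "q \<in> G" "p \<in> G"
  shows "(G_mult q has_derivative (\<lambda>v. snd q *\<^sub>R v)) (at p)"
    and "X1 (G_mult q p) = snd q *\<^sub>R X1 p"
    and "X2 (G_mult q p) = snd q *\<^sub>R X2 p"
proof -
  have "((\<lambda>p. (fst q + snd q * fst p, snd q * snd p)) has_derivative (\<lambda>v. snd q *\<^sub>R v)) (at p)"
    by (auto intro!: derivative_eq_intros simp: prod_eq_iff)
  then show "(G_mult q has_derivative (\<lambda>v. snd q *\<^sub>R v)) (at p)"
    by (simp add: G_mult_def[abs_def])
qed (use assms in \<open>auto simp: X1_def X2_def on_G_def G_def G_mult_def split: prod.splits\<close>)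

lemma lorentz_metric_frame:
  assumes "p \<in> G"
  shows "lorentz_metric A p (u1 *\<^sub>R X1 p + u2 *\<^sub>R X2 p) (u1 *\<^sub>R X1 p + u2 *\<^sub>R X2 p)
    = - (A$1$1 * u1 + A$1$2 * u2)\<^sup>2 + (A$2$1 * u1 + A$2$2 * u2)\<^sup>2"
  using assms
  by (auto simp: lorentz_metric_def frame_coords_def X1_def X2_def on_G_def G_def
      matrix_vector_mult_def sum_2 power2_eq_square algebra_simps split: prod.splits)


section \<open>Levi-Civita connection and sectional curvature\<close>

text \<open>\<open>koszul g X Y Z\<close> is \<open>2 g(\<nabla>\<^sub>X Y, Z)\<close>.\<close>

definition koszul :: "metric \<Rightarrow> field \<Rightarrow> field \<Rightarrow> field \<Rightarrow> real \<times> real \<Rightarrow> real"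
  where "koszul g X Y Z p =
    deriv_along X (\<lambda>q. g q (Y q) (Z q)) p
    + deriv_along Y (\<lambda>q. g q (X q) (Z q)) p
    - deriv_along Z (\<lambda>q. g q (X q) (Y q)) p
    + g p (bracket X Y p) (Z p)
    - g p (bracket X Z p) (Y p)
    - g p (bracket Y Z p) (X p)"

definition levi_civita :: "metric \<Rightarrow> field \<Rightarrow> field \<Rightarrow> field"
  where "levi_civita g X Y =
    on_G (\<lambda>p. THE w. \<forall>Z. smooth_field Z \<longrightarrow> 2 * g p w (Z p) = koszul g X Y Z p)"

definition curvature :: "metric \<Rightarrow> field \<Rightarrow> field \<Rightarrow> field \<Rightarrow> field"
  where "curvature g X Y Z =
    levi_civita g X (levi_civita g Y Z) - levi_civita g Y (levi_civita g X Z)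
    - levi_civita g (bracket X Y) Z"

text \<open>
  The surface has a single tangent plane at each point; it is computed here from its
  basis \<open>X1\<close>, \<open>X2\<close>, and the value does not depend on that choice.
\<close>

definition sectional_curvature :: "metric \<Rightarrow> real \<times> real \<Rightarrow> real"
  where "sectional_curvature g p =
    g p (curvature g X1 X2 X2 p) (X1 p)
    / (g p (X1 p) (X1 p) * g p (X2 p) (X2 p) - (g p (X1 p) (X2 p))\<^sup>2)"


section \<open>Killing vector fields\<close>

definition lie_derivative :: "field \<Rightarrow> metric \<Rightarrow> field \<Rightarrow> field \<Rightarrow> real \<times> real \<Rightarrow> real"
  where "lie_derivative X g Y Z p =
    deriv_along X (\<lambda>q. g q (Y q) (Z q)) p - g p (bracket X Y p) (Z p) - g p (Y p) (bracket X Z p)"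

definition killing_fields :: "metric \<Rightarrow> field set"
  where "killing_fields g = {X. smooth_field X \<and>
    (\<forall>Y Z. smooth_field Y \<longrightarrow> smooth_field Z \<longrightarrow> (\<forall>p\<in>G. lie_derivative X g Y Z p = 0))}"

definition Xt1 :: field
  where "Xt1 = on_G (\<lambda>(x, y). (1, 0))"

definition Xt2 :: field
  where "Xt2 = on_G (\<lambda>(x, y). (x, y))"

definition g_const :: "real ^ 2 ^ 2 \<Rightarrow> real"
  where "g_const A = (let B = matrix_inv A in
    - (B$1$1 + sgn (B$2$1) * B$1$2) / (2 * B$2$1))"

definition X0 :: "real ^ 2 ^ 2 \<Rightarrow> field"
  where "X0 A = on_G (\<lambda>(x, y). (x + g_const A * (y\<^sup>2 - 1), y * (1 - y)))"


section \<open>Real Lie algebras and their isomorphism\<close>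

definition lie_algebra_on :: "'a::real_vector set \<Rightarrow> ('a \<Rightarrow> 'a \<Rightarrow> 'a) \<Rightarrow> bool"
  where "lie_algebra_on V br \<longleftrightarrow>
    subspace V \<and>
    (\<forall>x\<in>V. \<forall>y\<in>V. br x y \<in> V) \<and>
    (\<forall>x\<in>V. \<forall>y\<in>V. \<forall>z\<in>V. \<forall>r s. br (r *\<^sub>R x + s *\<^sub>R y) z = r *\<^sub>R br x z + s *\<^sub>R br y z) \<and>
    (\<forall>x\<in>V. \<forall>y\<in>V. \<forall>z\<in>V. \<forall>r s. br z (r *\<^sub>R x + s *\<^sub>R y) = r *\<^sub>R br z x + s *\<^sub>R br z y) \<and>
    (\<forall>x\<in>V. br x x = 0) \<and>
    (\<forall>x\<in>V. \<forall>y\<in>V. \<forall>z\<in>V. br x (br y z) + br y (br z x) + br z (br x y) = 0)"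

definition lie_algebra_isomorphic ::
  "'a::real_vector set \<Rightarrow> ('a \<Rightarrow> 'a \<Rightarrow> 'a) \<Rightarrow> 'b::real_vector set \<Rightarrow> ('b \<Rightarrow> 'b \<Rightarrow> 'b) \<Rightarrow> bool"
  where "lie_algebra_isomorphic V br W br' \<longleftrightarrow>
    lie_algebra_on V br \<and> lie_algebra_on W br' \<and>
    (\<exists>\<phi>. bij_betw \<phi> V W \<and>
      (\<forall>x\<in>V. \<forall>y\<in>V. \<phi> (x + y) = \<phi> x + \<phi> y) \<and>
      (\<forall>x\<in>V. \<forall>r. \<phi> (r *\<^sub>R x) = r *\<^sub>R \<phi> x) \<and>
      (\<forall>x\<in>V. \<forall>y\<in>V. \<phi> (br x y) = br' (\<phi> x) (\<phi> y)))"


section \<open>The group of hyperbolic motions of the plane and its Lie algebra\<close>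

text \<open>The flow of \<open>y \<partial>\<^sub>x + x \<partial>\<^sub>y\<close> at time \<open>t\<close>.\<close>

definition hyp_rotation :: "real \<Rightarrow> real ^ 2 \<Rightarrow> real ^ 2"
  where "hyp_rotation t v = vector [cosh t * v$1 + sinh t * v$2, sinh t * v$1 + cosh t * v$2]"

inductive_set SH2 :: "(real ^ 2 \<Rightarrow> real ^ 2) set"
  where
    identity: "id \<in> SH2"
  | translation: "(\<lambda>v. v + w) \<in> SH2"
  | rotation: "hyp_rotation t \<in> SH2"
  | composition: "f \<in> SH2 \<Longrightarrow> h \<in> SH2 \<Longrightarrow> f \<circ> h \<in> SH2"
  | inverse: "f \<in> SH2 \<Longrightarrow> inv f \<in> SH2"

text \<open>
  The standard realisation of a group of affine maps of the plane as a matrix group: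
  \<open>f\<close> is represented by the matrix sending \<open>(v, 1)\<close> to \<open>(f v, 1)\<close> for all \<open>v\<close>;
  this matrix is unique.
\<close>

definition affine_matrices :: "(real ^ 2 \<Rightarrow> real ^ 2) set \<Rightarrow> (real ^ 3 ^ 3) set"
  where "affine_matrices F = {M. \<exists>f\<in>F. \<forall>v.
    M *v vector [v$1, v$2, 1] = vector [f v $ 1, f v $ 2, 1]}"

text \<open>
  The Lie algebra of a matrix group \<open>H\<close> consists of the \<open>M\<close> with \<open>exp (t M) \<in> H\<close> for
  all \<open>t\<close>, that is, of the velocities at \<open>0\<close> of the one-parameter subgroups of \<open>H\<close>.
  Its bracket is the commutator.
\<close>

definition lie_algebra_of :: "(real ^ 'n ^ 'n) set \<Rightarrow> (real ^ 'n ^ 'n) set"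
  where "lie_algebra_of H = {M. \<exists>\<gamma>::real \<Rightarrow> real ^ 'n ^ 'n.
    range \<gamma> \<subseteq> H \<and> \<gamma> 0 = mat 1 \<and> (\<forall>s t. \<gamma> (s + t) = \<gamma> s ** \<gamma> t) \<and>
    (\<gamma> has_vector_derivative M) (at 0)}"

definition commutator :: "real ^ 'n ^ 'n \<Rightarrow> real ^ 'n ^ 'n \<Rightarrow> real ^ 'n ^ 'n"
  where "commutator M N = M ** N - N ** M"

definition sh2 :: "(real ^ 3 ^ 3) set"
  where "sh2 = lie_algebra_of (affine_matrices SH2)"

end

theory Submission
  imports Defs
begin

text \<open>
  In the left-invariant frame the metric is a constant bilinear form, so in the coordinates
  \<open>(x, y)\<close> it is that form divided by \<open>y\<^sup>2\<close>. The Koszul formula then gives a closed expression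
  for the Levi-Civita connection, which on left-invariant fields is an algebraic operation; from
  it the curvature comes out as \<open>(c\<^sup>2 - a\<^sup>2) / (det A)\<^sup>2\<close>
  for \<open>A\<close> with rows \<open>(a, b)\<close> and \<open>(c, d)\<close> (\<open>sectional_curvature_eq\<close>).

  If \<open>c\<^sup>2 = a\<^sup>2\<close>, then \<open>\<partial>\<^sub>x\<close> is a null direction and the metric is a nonzero constant times
  \<open>dy (dx + g dy) / y\<^sup>2\<close> with \<open>g = g_const A\<close> (\<open>g_const_eq\<close>). In the null coordinates
  \<open>w = x + g y\<close> and \<open>z = - 1 / y\<close> this is \<open>dz dw\<close>: the surface is the half \<open>z < 0\<close> of the
  Minkowski plane. Its Killing fields are those of the Minkowski plane, spanned by the two null
  translations and the boost
  \<open>\<partial>\<^sub>w = \<partial>\<^sub>x\<close>, \<open>\<partial>\<^sub>z = y\<^sup>2 (\<partial>\<^sub>y - g \<partial>\<^sub>x)\<close> and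
  \<open>w \<partial>\<^sub>w - z \<partial>\<^sub>z = x \<partial>\<^sub>x + y \<partial>\<^sub>y\<close>. That there are no others is an elementary integration of the
  Killing equation (\<open>killing_equation_solution\<close>). In this basis \<open>Xt1 = \<partial>\<^sub>w\<close>,
  \<open>Xt2\<close> is the boost, and \<open>X0 A\<close> is the boost minus \<open>(g \<partial>\<^sub>w + \<partial>\<^sub>z)\<close>, which explains all
  the brackets.

  The algebra \<open>sh2\<close> consists of the affine vector fields generated by the boost and the
  translations of the same plane (\<open>sh2_eq\<close>). Both algebras are images of \<open>\<real>\<^sup>3\<close> under
  injective linear maps that carry one and the same bracket \<open>param_bracket\<close> to theirs, hence they
  are isomorphic.
\<close>

section \<open>Smooth fields\<close>

lemma open_G: "open G"
  unfolding G_def by (intro open_Collect_less continuous_intros)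

lemma has_derivative_cong_open:
  assumes "open S" "x \<in> S" "\<And>y. y \<in> S \<Longrightarrow> f y = g y"
  shows "(f has_derivative D) (at x) \<longleftrightarrow> (g has_derivative D) (at x)"
  using has_derivative_transform_within_open[of f D x UNIV S g]
    has_derivative_transform_within_open[of g D x UNIV S f] assms by auto

lemma Ck_on_cong:
  assumes "open S" "\<And>x. x \<in> S \<Longrightarrow> f x = g x"
  shows "Ck_on k S f \<longleftrightarrow> Ck_on k S g"
  using assms(2)
proof (induction k arbitrary: f g)
  case 0
  then show ?case by (simp cong: continuous_on_cong)
next
  case (Suc k)
  have der: "(f has_derivative D) (at x) \<longleftrightarrow> (g has_derivative D) (at x)" if "x \<in> S" for x D
    using has_derivative_cong_open[OF assms(1) that] Suc.prems by blast
  have "frechet_derivative f (at x) = frechet_derivative g (at x)" if "x \<in> S" for x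
    using der[OF that] by (simp add: frechet_derivative_def)
  then have "Ck_on k S (\<lambda>x. frechet_derivative f (at x) v)
      \<longleftrightarrow> Ck_on k S (\<lambda>x. frechet_derivative g (at x) v)" for v
    by (intro Suc.IH) simp
  with der show ?case by (simp add: differentiable_def)
qed

text \<open>
  A derivative known in closed form spares the product and chain rules for \<open>C\<^sup>k\<close> maps: the
  fields of interest are polynomial, and differentiating them a few times reaches constants.
\<close>

lemma Ck_on_of_derivative:
  assumes "open S" "\<And>x. x \<in> S \<Longrightarrow> (f has_derivative f' x) (at x)"
    and "\<And>k v. Ck_on k S (\<lambda>x. f' x v)"
  shows "Ck_on k S f"
proof (cases k)
  case 0
  have "continuous_on S f"
    by (intro continuous_at_imp_continuous_on ballI has_derivative_continuous)
      (rule assms(2))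
  with 0 show ?thesis by simp
next
  case (Suc j)
  have eq: "frechet_derivative f (at x) v = f' x v" if "x \<in> S" for x v
    using frechet_derivative_at[OF assms(2)[OF that]] by simp
  have "Ck_on j S (\<lambda>x. frechet_derivative f (at x) v)" for v
    using Ck_on_cong[OF assms(1), of "\<lambda>x. frechet_derivative f (at x) v" "\<lambda>x. f' x v" j] eq assms(3)
    by blast
  with Suc assms(2) show ?thesis by (auto simp: differentiable_def)
qed

lemma Ck_on_const: "Ck_on k S (\<lambda>x. c)"
proof (induction k arbitrary: c)
  case (Suc k)
  then show ?case by (simp add: frechet_derivative_const[abs_def])
qed simp

lemma smooth_field_on_G:
  assumes "\<And>k. Ck_on k G X"
  shows "smooth_field (on_G X)"
  using assms Ck_on_cong[OF open_G, of "on_G X" X] by (auto simp: smooth_field_def on_G_def)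

text \<open>
  Constant fields take every value at a given point, so they suffice as test fields in the
  definitions of Killing fields and of the Levi-Civita connection.
\<close>

lemma smooth_const: "smooth_field (on_G (\<lambda>p. v))"
  by (rule smooth_field_on_G) (rule Ck_on_const)

lemma on_G_has_derivative:
  assumes "p \<in> G" "(X has_derivative D) (at p)"
  shows "(on_G X has_derivative D) (at p)"
  using has_derivative_cong_open[OF open_G assms(1), of "on_G X" X] assms(2)
  by (auto simp: on_G_def)

lemma smooth_has_derivative:
  assumes "smooth_field X" "p \<in> G"
  shows "(X has_derivative frechet_derivative X (at p)) (at p)"
proof -
  have "Ck_on (Suc 0) G X" using assms(1) unfolding smooth_field_def by blast
  then show ?thesis using assms(2) by (simp add: frechet_derivative_works)
qed

lemma bracket_eq:
  assumes "p \<in> G" "(X has_derivative DX) (at p)" "(Y has_derivative DY) (at p)"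
  shows "bracket X Y p = DY (X p) - DX (Y p)"
  using assms frechet_derivative_at[OF assms(2)] frechet_derivative_at[OF assms(3)]
  by (simp add: bracket_def on_G_def deriv_along_def)


section \<open>The metric as a conformal factor times a constant bilinear form\<close>

text \<open>
  The value of the metric at the identity \<open>(0, 1)\<close>, a point with \<open>y = 1\<close>.
\<close>

definition left_form :: "real^2^2 \<Rightarrow> real \<times> real \<Rightarrow> real \<times> real \<Rightarrow> real"
  where "left_form A v w =
    (A$2$1 ^ 2 - A$1$1 ^ 2) * (fst v * fst w)
    + (A$2$1 * A$2$2 - A$1$1 * A$1$2) * (fst v * snd w + snd v * fst w)
    + (A$2$2 ^ 2 - A$1$2 ^ 2) * (snd v * snd w)"

lemma lorentz_metric_eq: "lorentz_metric A p v w = left_form A v w / (snd p)\<^sup>2"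
  by (simp add: lorentz_metric_def frame_coords_def left_form_def matrix_vector_mult_def sum_2
      power2_eq_square diff_divide_distrib add_divide_distrib algebra_simps)

lemma bounded_bilinear_left_form: "bounded_bilinear (left_form A)"
  unfolding bilinear_conv_bounded_bilinear[symmetric] bilinear_def
  by (auto intro!: linearI simp: left_form_def algebra_simps)

lemmas left_form_bilinear =
  bounded_bilinear.add_left[OF bounded_bilinear_left_form]
  bounded_bilinear.add_right[OF bounded_bilinear_left_form]
  bounded_bilinear.diff_left[OF bounded_bilinear_left_form]
  bounded_bilinear.diff_right[OF bounded_bilinear_left_form]
  bounded_bilinear.scaleR_left[OF bounded_bilinear_left_form]
  bounded_bilinear.scaleR_right[OF bounded_bilinear_left_form]

lemma left_form_commute: "left_form A v w = left_form A w v"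
  by (simp add: left_form_def algebra_simps)

lemma deriv_along_metric:
  assumes p: "p \<in> G" and Y: "(Y has_derivative DY) (at p)" and Z: "(Z has_derivative DZ) (at p)"
  shows "deriv_along X (\<lambda>q. lorentz_metric A q (Y q) (Z q)) p =
    (left_form A (DY (X p)) (Z p) + left_form A (Y p) (DZ (X p))
      - 2 * (snd (X p) / snd p) * left_form A (Y p) (Z p)) / (snd p)\<^sup>2"
proof -
  have y: "snd p \<noteq> 0" using p by (simp add: G_def)
  have 1: "((\<lambda>q. left_form A (Y q) (Z q)) has_derivative
      (\<lambda>h. left_form A (Y p) (DZ h) + left_form A (DY h) (Z p))) (at p)"
    by (rule bounded_bilinear.FDERIV[OF bounded_bilinear_left_form Y Z])
  have 2: "((\<lambda>q::real\<times>real. (snd q)\<^sup>2) has_derivative (\<lambda>h. 2 * snd p * snd h)) (at p)"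
    by (auto intro!: derivative_eq_intros)
  have "((\<lambda>q. left_form A (Y q) (Z q) / (snd q)\<^sup>2) has_derivative
      (\<lambda>h. (left_form A (DY h) (Z p) + left_form A (Y p) (DZ h)
      - 2 * (snd h / snd p) * left_form A (Y p) (Z p)) / (snd p)\<^sup>2)) (at p)"
    by (rule has_derivative_eq_rhs[OF has_derivative_divide[OF 1 2]])
      (use y in \<open>auto simp: fun_eq_iff field_simps power2_eq_square\<close>)
  from frechet_derivative_at[OF this, symmetric] show ?thesis
    by (simp add: deriv_along_def lorentz_metric_eq)
qed

text \<open>
  The derivatives of \<open>Y\<close> and \<open>Z\<close> cancel: the Lie derivative of the metric is a tensor.
\<close>

lemma lie_derivative_metric:
  assumes p: "p \<in> G" and X: "(X has_derivative DX) (at p)"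
    and Y: "(Y has_derivative DY) (at p)" and Z: "(Z has_derivative DZ) (at p)"
  shows "lie_derivative X (lorentz_metric A) Y Z p =
    (left_form A (DX (Y p)) (Z p) + left_form A (Y p) (DX (Z p))
      - 2 * (snd (X p) / snd p) * left_form A (Y p) (Z p)) / (snd p)\<^sup>2"
  unfolding lie_derivative_def deriv_along_metric[OF p Y Z] bracket_eq[OF p X Y] bracket_eq[OF p X Z]
  by (simp add: lorentz_metric_eq left_form_bilinear diff_divide_distrib add_divide_distrib)

text \<open>
  By tensoriality the Killing condition is a first-order equation on \<open>X\<close> at each point; the
  right-hand side comes from differentiating the conformal factor \<open>1 / y\<^sup>2\<close>.
\<close>

lemma killing_fields_iff:
  "X \<in> killing_fields (lorentz_metric A) \<longleftrightarrow> smooth_field X \<and>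
    (\<forall>p\<in>G. \<forall>v w. left_form A (frechet_derivative X (at p) v) w
      + left_form A v (frechet_derivative X (at p) w) = 2 * (snd (X p) / snd p) * left_form A v w)"
  (is "_ \<longleftrightarrow> _ \<and> (\<forall>p\<in>G. \<forall>v w. ?E p v w)")
proof (intro iffI conjI ballI allI)
  assume K: "X \<in> killing_fields (lorentz_metric A)"
  then show X: "smooth_field X" by (simp add: killing_fields_def)
  fix p v w assume p: "p \<in> G"
  have "lie_derivative X (lorentz_metric A) (on_G (\<lambda>_. v)) (on_G (\<lambda>_. w)) p = 0"
    using K p smooth_const unfolding killing_fields_def by blast
  moreover have const: "(on_G (\<lambda>_. u) has_derivative (\<lambda>_. 0)) (at p)" for u
    by (intro on_G_has_derivative[OF p] has_derivative_const)
  ultimately show "?E p v w"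
    unfolding lie_derivative_metric[OF p smooth_has_derivative[OF X p] const const]
    using p by (simp add: on_G_def G_def)
next
  assume K: "smooth_field X \<and> (\<forall>p\<in>G. \<forall>v w. ?E p v w)"
  have "lie_derivative X (lorentz_metric A) Y Z p = 0"
    if "smooth_field Y" "smooth_field Z" "p \<in> G" for Y Z p
  proof -
    have "lie_derivative X (lorentz_metric A) Y Z p =
      (left_form A (frechet_derivative X (at p) (Y p)) (Z p)
        + left_form A (Y p) (frechet_derivative X (at p) (Z p))
        - 2 * (snd (X p) / snd p) * left_form A (Y p) (Z p)) / (snd p)\<^sup>2"
      by (rule lie_derivative_metric[OF that(3) smooth_has_derivative[OF _ that(3)]
            smooth_has_derivative[OF that(1,3)] smooth_has_derivative[OF that(2,3)]])
        (use K in blast)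
    moreover have "?E p (Y p) (Z p)" using K that(3) by blast
    ultimately show ?thesis by (simp only: diff_self div_0)
  qed
  with K show "X \<in> killing_fields (lorentz_metric A)" by (simp add: killing_fields_def)
qed


section \<open>Levi-Civita connection and curvature\<close>

text \<open>
  The derivatives of \<open>Z\<close> cancel, so the Koszul expression is linear in the value \<open>Z p\<close>. The
  terms with second components come from differentiating the conformal factor \<open>1 / y\<^sup>2\<close>.
\<close>

lemma koszul_metric:
  assumes p: "p \<in> G" and X: "(X has_derivative DX) (at p)"
    and Y: "(Y has_derivative DY) (at p)" and Z: "(Z has_derivative DZ) (at p)"
  shows "koszul (lorentz_metric A) X Y Z p =
    2 * (left_form A (DY (X p) - (snd (X p) / snd p) *\<^sub>R Y p - (snd (Y p) / snd p) *\<^sub>R X p) (Z p)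
      + snd (Z p) / snd p * left_form A (X p) (Y p)) / (snd p)\<^sup>2"
  unfolding koszul_def deriv_along_metric[OF p Y Z] deriv_along_metric[OF p X Y]
    deriv_along_metric[OF p X Z] bracket_eq[OF p X Y] bracket_eq[OF p X Z] bracket_eq[OF p Y Z]
  by (simp add: lorentz_metric_eq left_form_bilinear diff_divide_distrib add_divide_distrib
      left_form_commute algebra_simps)

text \<open>
  The vector that represents the linear form \<open>dy\<close> with respect to \<open>left_form A\<close>. It turns the last
  term of the Koszul formula into a scalar product with \<open>Z\<close>.
\<close>

definition dy_sharp :: "real^2^2 \<Rightarrow> real \<times> real"
  where "dy_sharp A = (1 / (det A)\<^sup>2) *\<^sub>R
    (A$2$1 * A$2$2 - A$1$1 * A$1$2, A$1$1 ^ 2 - A$2$1 ^ 2)"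

lemma left_form_dy_sharp:
  assumes "det A \<noteq> 0"
  shows "left_form A (dy_sharp A) v = snd v"
proof -
  have "left_form A (dy_sharp A) v = (det A)\<^sup>2 * snd v / (det A)\<^sup>2"
    by (simp add: left_form_def dy_sharp_def det_2 power2_eq_square diff_divide_distrib
        add_divide_distrib algebra_simps)
  with assms show ?thesis by simp
qed

lemma left_form_nondegenerate:
  assumes "det A \<noteq> 0" "\<And>z. left_form A v z = left_form A w z"
  shows "v = w"
proof -
  define u where "u = v - w"
  have 0: "left_form A z u = 0" for z
    using assms(2) by (simp add: u_def left_form_bilinear left_form_commute[of A z])
  have s: "snd u = 0"
    using 0[of "dy_sharp A"] left_form_dy_sharp[OF assms(1)] by simp
  have E: "(A$2$1 ^ 2 - A$1$1 ^ 2) * fst u = 0"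
    using 0[of "(1,0)"] s by (simp add: left_form_def)
  have F: "(A$2$1 * A$2$2 - A$1$1 * A$1$2) * fst u = 0"
    using 0[of "(0,1)"] s by (simp add: left_form_def)
  \<comment> \<open>the Gram determinant of \<open>left_form A\<close> is \<open>- (det A)\<^sup>2\<close>\<close>
  have "(det A)\<^sup>2 * fst u = (A$2$1 * A$2$2 - A$1$1 * A$1$2) * ((A$2$1 * A$2$2 - A$1$1 * A$1$2) * fst u)
     - (A$2$2 ^ 2 - A$1$2 ^ 2) * ((A$2$1 ^ 2 - A$1$1 ^ 2) * fst u)"
    by (simp add: det_2 power2_eq_square algebra_simps)
  with E F have "(det A)\<^sup>2 * fst u = 0" by (simp only: mult_zero_right diff_self)
  with assms(1) have "fst u = 0" by simp
  with s show ?thesis by (simp add: u_def prod_eq_iff)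
qed

lemma levi_civita_metric:
  assumes A: "det A \<noteq> 0" and p: "p \<in> G"
    and X: "(X has_derivative DX) (at p)" and Y: "(Y has_derivative DY) (at p)"
  shows "levi_civita (lorentz_metric A) X Y p =
    DY (X p) - (snd (X p) / snd p) *\<^sub>R Y p - (snd (Y p) / snd p) *\<^sub>R X p
    + (left_form A (X p) (Y p) / snd p) *\<^sub>R dy_sharp A" (is "_ = ?w")
proof -
  have y: "snd p > 0" using p by (simp add: G_def)
  have half: "2 * (a / (snd p)\<^sup>2) = 2 * b / (snd p)\<^sup>2 \<longleftrightarrow> a = b" for a b
    using y by (simp add: field_simps)
  have iff: "2 * lorentz_metric A p w (Z p) = koszul (lorentz_metric A) X Y Z p
      \<longleftrightarrow> left_form A w (Z p) = left_form A ?w (Z p)" if "smooth_field Z" for w Z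
    unfolding koszul_metric[OF p X Y smooth_has_derivative[OF that p]]
    unfolding lorentz_metric_eq half by (simp add: left_form_bilinear left_form_dy_sharp[OF A] mult.commute)
  have "(THE w. \<forall>Z. smooth_field Z \<longrightarrow> 2 * lorentz_metric A p w (Z p)
      = koszul (lorentz_metric A) X Y Z p) = ?w"
  proof (rule the_equality)
    fix w assume w: "\<forall>Z. smooth_field Z \<longrightarrow> 2 * lorentz_metric A p w (Z p)
      = koszul (lorentz_metric A) X Y Z p"
    have "left_form A w z = left_form A ?w z" for z
      using w[rule_format, OF smooth_const[of z]] iff[OF smooth_const[of z], of w] p
      by (simp add: on_G_def)
    then show "w = ?w" by (rule left_form_nondegenerate[OF A])
  qed (use iff in blast)
  with p show ?thesis by (simp add: levi_civita_def on_G_def)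
qed

definition left_field :: "real \<times> real \<Rightarrow> field"
  where "left_field u = on_G (\<lambda>p. snd p *\<^sub>R u)"

lemma X1_left_field: "X1 = left_field (1, 0)" and X2_left_field: "X2 = left_field (0, 1)"
  by (auto simp: X1_def X2_def left_field_def on_G_def fun_eq_iff)

lemma left_field_has_derivative:
  assumes "p \<in> G"
  shows "(left_field u has_derivative (\<lambda>h. snd h *\<^sub>R u)) (at p)"
  unfolding left_field_def
  by (rule on_G_has_derivative[OF assms]) (auto intro!: derivative_eq_intros)

lemma bracket_left_field:
  "bracket (left_field u) (left_field w) = left_field (snd u *\<^sub>R w - snd w *\<^sub>R u)"
proof
  fix p
  show "bracket (left_field u) (left_field w) p = left_field (snd u *\<^sub>R w - snd w *\<^sub>R u) p"
  proof (cases "p \<in> G")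
    case True
    show ?thesis
      unfolding bracket_eq[OF True left_field_has_derivative[OF True] left_field_has_derivative[OF True]]
      using True by (simp add: left_field_def on_G_def algebra_simps)
  qed (simp add: bracket_def left_field_def on_G_def)
qed

text \<open>
  Left-invariant fields are closed under the connection, since its coefficients in the frame are
  constant. Iterated covariant derivatives therefore need no further differentiation.
\<close>

lemma levi_civita_left_field:
  assumes A: "det A \<noteq> 0"
  shows "levi_civita (lorentz_metric A) (left_field u) (left_field w) =
    left_field (left_form A u w *\<^sub>R dy_sharp A - snd w *\<^sub>R u)"
proof
  fix p
  show "levi_civita (lorentz_metric A) (left_field u) (left_field w) p =
    left_field (left_form A u w *\<^sub>R dy_sharp A - snd w *\<^sub>R u) p"
  proof (cases "p \<in> G")
    case True
    then have "snd p \<noteq> 0" by (simp add: G_def)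
    then show ?thesis
      unfolding levi_civita_metric[OF A True left_field_has_derivative[OF True]
          left_field_has_derivative[OF True]]
      using True by (simp add: left_field_def on_G_def left_form_bilinear algebra_simps)
  qed (simp add: levi_civita_def left_field_def on_G_def)
qed

text \<open>
  With \<open>n = dy_sharp A\<close> and the basis \<open>e1, e2\<close>, the connection formula gives
  \<open>R(e1, e2) e2 = snd n (F e2 - H e1)\<close>. Its product with \<open>e1\<close> is \<open>- snd n\<close> times the Gram determinant,
  so the curvature is \<open>- snd n\<close>, the square of \<open>e1\<close> divided by \<open>(det A)\<^sup>2\<close>.
\<close>

lemma sectional_curvature_eq:
  assumes A: "det A \<noteq> 0" and p: "p \<in> G"
  shows "sectional_curvature (lorentz_metric A) p = (A$2$1 ^ 2 - A$1$1 ^ 2) / (det A)\<^sup>2"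
proof -
  let ?g = "lorentz_metric A"
  have y: "snd p > 0" using p by (simp add: G_def)
  have sharp: "- snd (dy_sharp A) = (A$2$1 ^ 2 - A$1$1 ^ 2) / (det A)\<^sup>2"
    by (simp add: dy_sharp_def minus_divide_left)
  have n: "left_form A w (dy_sharp A) = snd w" for w
    using left_form_dy_sharp[OF A, of w] by (simp add: left_form_commute)
  define e1 e2 :: "real \<times> real" where "e1 = (1, 0)" and "e2 = (0, 1)"
  have [simp]: "snd e1 = 0" "snd e2 = 1" by (simp_all add: e1_def e2_def)
  define F H where "F = left_form A e1 e2" and "H = left_form A e2 e2"
  have gram: "left_form A e1 e1 * H - F\<^sup>2 = - (det A)\<^sup>2"
    by (simp add: F_def H_def e1_def e2_def left_form_def det_2 power2_eq_square algebra_simps)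
  have [simp]: "left_form A e2 e1 = F" "left_form A e1 e2 = F" "left_form A e2 e2 = H"
    by (simp_all add: F_def H_def left_form_commute)
  have X: "X1 = left_field e1" "X2 = left_field e2"
    by (simp_all add: X1_left_field X2_left_field e1_def e2_def)
  have minus: "left_form A (- e1) e2 = - F"
    by (simp add: bounded_bilinear.minus_left[OF bounded_bilinear_left_form])
  have frame: "left_field u p = snd p *\<^sub>R u" for u
    using p by (simp add: left_field_def on_G_def)
  have "curvature ?g X1 X2 X2 p = (snd p * snd (dy_sharp A)) *\<^sub>R (F *\<^sub>R e2 - H *\<^sub>R e1)"
    unfolding curvature_def X bracket_left_field levi_civita_left_field[OF A]
    by (simp add: frame left_form_bilinear n minus algebra_simps)
  then have "?g p (curvature ?g X1 X2 X2 p) (X1 p)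
      = ?g p ((snd p * snd (dy_sharp A)) *\<^sub>R (F *\<^sub>R e2 - H *\<^sub>R e1)) (snd p *\<^sub>R e1)"
    by (simp only: X frame)
  also have "\<dots> = snd (dy_sharp A) * (F\<^sup>2 - left_form A e1 e1 * H)"
    using y by (simp add: lorentz_metric_eq left_form_bilinear field_simps power2_eq_square)
  finally have "?g p (curvature ?g X1 X2 X2 p) (X1 p)
      = snd (dy_sharp A) * (F\<^sup>2 - left_form A e1 e1 * H)" .
  moreover have "?g p (X1 p) (X1 p) * ?g p (X2 p) (X2 p) - (?g p (X1 p) (X2 p))\<^sup>2
      = left_form A e1 e1 * H - F\<^sup>2"
    using y by (simp add: X frame lorentz_metric_eq left_form_bilinear power2_eq_square)
  moreover have "F\<^sup>2 - left_form A e1 e1 * H = (det A)\<^sup>2" using gram by simp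
  ultimately have "sectional_curvature ?g p = snd (dy_sharp A) * (det A)\<^sup>2 / - (det A)\<^sup>2"
    unfolding sectional_curvature_def gram[symmetric] by (simp only:)
  also have "\<dots> = - snd (dy_sharp A)" using A by simp
  finally show ?thesis unfolding sharp .
qed


section \<open>Solving the Killing equation\<close>

text \<open>
  The field \<open>f \<partial>\<^sub>w + c (w \<partial>\<^sub>w - z \<partial>\<^sub>z) + e \<partial>\<^sub>z\<close> for the null coordinates \<open>w = x + g y\<close>,
  \<open>z = - 1 / y\<close>, written out in \<open>(x, y)\<close>.
\<close>

definition killing_param :: "real \<Rightarrow> real \<times> real \<times> real \<Rightarrow> field"
  where "killing_param g = (\<lambda>(f, c, e).
    on_G (\<lambda>(x, y). (f + c * x - g * e * y\<^sup>2, c * y + e * y\<^sup>2)))"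

lemma killing_param_has_derivative:
  assumes "p \<in> G"
  shows "(killing_param g (f, c, e) has_derivative
    (\<lambda>h. (c * fst h - 2 * g * e * snd p * snd h, c * snd h + 2 * e * snd p * snd h))) (at p)"
  unfolding killing_param_def case_prod_beta fst_conv snd_conv
  by (rule on_G_has_derivative[OF assms])
    (auto intro!: derivative_eq_intros simp: fun_eq_iff algebra_simps)

lemma smooth_killing_param: "smooth_field (killing_param g u)"
proof -
  obtain f c e where u: "u = (f, c, e)" by (cases u)
  have "Ck_on k G (killing_param g u)" for k
    unfolding u
  proof (rule Ck_on_of_derivative[OF open_G killing_param_has_derivative])
    fix k and h :: "real \<times> real"
    show "Ck_on k G (\<lambda>p. (c * fst h - 2 * g * e * snd p * snd h, c * snd h + 2 * e * snd p * snd h))"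
      by (rule Ck_on_of_derivative[OF open_G, where f' = "\<lambda>_ h'.
            (- 2 * g * e * snd h' * snd h, 2 * e * snd h' * snd h)"])
        (auto intro!: derivative_eq_intros Ck_on_const)
  qed
  then show ?thesis
    by (simp add: smooth_field_def killing_param_def on_G_def case_prod_beta)
qed

lemma linear_killing_param: "linear (killing_param g)"
  by (rule linearI)
    (auto simp: killing_param_def on_G_def fun_eq_iff scaleR_fun_def algebra_simps)

lemma inj_killing_param: "inj (killing_param g)"
proof (rule injI)
  fix u v assume eq: "killing_param g u = killing_param g v"
  obtain f c e f' c' e' where u: "u = (f, c, e)" "v = (f', c', e')" by (cases u, cases v)
  from eq have "killing_param g u q = killing_param g v q" for q by simp
  from this[of "(0,1)"] this[of "(1,1)"]
  have "f + c - g * e = f' + c' - g * e'" "f - g * e = f' - g * e'" "c + e = c' + e'"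
    by (simp_all add: u killing_param_def on_G_def G_def)
  then have "c = c'" "e = e'" by auto
  with \<open>f - g * e = f' - g * e'\<close> have "f = f'" by simp
  note \<open>c = c'\<close> \<open>e = e'\<close> \<open>f = f'\<close>
  then show "u = v" by (simp add: u)
qed

text \<open>
  The three equations are the components of the Killing equation for \<open>dy (dx + g dy) / y\<^sup>2\<close>. Write
  \<open>X = (P, Q)\<close>. The first makes \<open>Q\<close> a function of \<open>y\<close> alone; then the other two say that both partial
  derivatives of \<open>P\<close> depend on \<open>y\<close> alone. So \<open>P\<close> is affine in \<open>x\<close> with a slope that is
  independent of \<open>y\<close> (otherwise \<open>\<partial>\<^sub>y P\<close> would depend on \<open>x\<close>), and what remains are two
  ordinary differential equations. Only first derivatives of \<open>X\<close> enter.
\<close>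

lemma killing_equation_solution:
  fixes X :: field
  assumes X: "\<And>p. p \<in> G \<Longrightarrow> (X has_derivative D p) (at p)"
    and e1: "\<And>p. p \<in> G \<Longrightarrow> snd (D p (1,0)) = 0"
    and e2: "\<And>p. p \<in> G \<Longrightarrow> fst (D p (1,0)) + snd (D p (0,1)) = 2 * snd (X p) / snd p"
    and e3: "\<And>p. p \<in> G \<Longrightarrow> fst (D p (0,1)) = 2 * g * (snd (X p) / snd p - snd (D p (0,1)))"
    and off: "\<And>p. p \<notin> G \<Longrightarrow> X p = 0"
  shows "X \<in> range (killing_param g)"
proof -
  have G: "(x, y) \<in> G" if "y > 0" for x y using that by (simp add: G_def)
  have line: "((\<lambda>s. F (X (s, y))) has_real_derivative F (D (x, y) (1, 0))) (at x)"
    "((\<lambda>s. F (X (x, s))) has_real_derivative F (D (x, y) (0, 1))) (at y)"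
    if "bounded_linear F" "y > 0" for F x y
  proof -
    have lin: "linear (D (x,y))" using X[OF G[OF that(2)]] by (rule has_derivative_linear)
    have sc: "F (D (x,y) (h *\<^sub>R v)) = F (D (x,y) v) * h" for h v
      using linear_scale[OF lin, of h v] linear_scale[OF bounded_linear.linear[OF that(1)], of h]
      by simp
    have FX: "((\<lambda>p. F (X p)) has_derivative (\<lambda>h. F (D (x,y) h))) (at (x,y))"
      by (rule bounded_linear.has_derivative[OF that(1) X[OF G[OF that(2)]]])
    have h: "((\<lambda>s. (s, y)) has_derivative (\<lambda>h. h *\<^sub>R (1,0))) (at x)"
      by (auto intro!: derivative_eq_intros)
    have v: "((\<lambda>s. (x, s)) has_derivative (\<lambda>h. h *\<^sub>R (0,1))) (at y)"
      by (auto intro!: derivative_eq_intros)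
    show "((\<lambda>s. F (X (s, y))) has_real_derivative F (D (x, y) (1, 0))) (at x)"
      using has_derivative_compose[OF h FX] sc unfolding has_field_derivative_def by (simp del: scaleR_Pair)
    show "((\<lambda>s. F (X (x, s))) has_real_derivative F (D (x, y) (0, 1))) (at y)"
      using has_derivative_compose[OF v FX] sc unfolding has_field_derivative_def by (simp del: scaleR_Pair)
  qed
  note P = line[OF bounded_linear_fst] and Q = line[OF bounded_linear_snd]
  \<comment> \<open>all functions of \<open>y\<close> live on the half-line \<open>y > 0\<close>, with base point \<open>1\<close>\<close>
  have const: "k y = k 1" if "\<And>s. s > 0 \<Longrightarrow> (k has_real_derivative 0) (at s)" "y > 0"
    for k :: "real \<Rightarrow> real" and y
  proof -
    have "\<exists>c. \<forall>x\<in>{0<..}. k x = c"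
      by (rule has_field_derivative_zero_constant)
        (use that(1) in \<open>auto intro: has_field_derivative_at_within\<close>)
    with that(2) show ?thesis by force
  qed
  define q where "q s = snd (X (0, s))" for s
  define q' where "q' s = snd (D (0, s) (0,1))" for s
  have Qx: "snd (X (x, y)) = q y" if "y > 0" for x y
    unfolding q_def
    by (rule DERIV_isconst_all[of "\<lambda>s. snd (X (s, y))"])
      (use Q(1)[OF that] e1[OF G[OF that]] in auto)
  have q: "(q has_real_derivative q' y) (at y)" if "y > 0" for y
    using Q(2)[OF that, of 0] by (simp add: q_def[abs_def] q'_def)
  have Qy: "snd (D (x, y) (0,1)) = q' y" if "y > 0" for x y
  proof (rule DERIV_unique[OF _ q[OF that]])
    show "(q has_real_derivative snd (D (x, y) (0,1))) (at y)"
      by (rule DERIV_cong_ev[THEN iffD1, OF refl _ refl Q(2)[OF that, of x]])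
        (use that Qx in \<open>auto intro!: eventually_mono[OF eventually_gt_at_top] eventually_nhds_in_open[of "{0<..}", THEN eventually_mono]\<close>)
  qed
  have Px: "fst (D (x, y) (1,0)) = 2 * q y / y - q' y" if "y > 0" for x y
    using e2[OF G[OF that, of x]] Qy[OF that] Qx[OF that] by simp
  have Py: "fst (D (x, y) (0,1)) = 2 * g * (q y / y - q' y)" if "y > 0" for x y
    using e3[OF G[OF that, of x]] Qy[OF that] Qx[OF that] by simp
  have Plin: "fst (X (x, y)) = fst (X (0, y)) + (2 * q y / y - q' y) * x" if "y > 0" for x y
  proof -
    have "fst (X (x, y)) - (2 * q y / y - q' y) * x = fst (X (0, y)) - (2 * q y / y - q' y) * 0"
      by (rule DERIV_isconst_all[of "\<lambda>s. fst (X (s, y)) - (2 * q y / y - q' y) * s"])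
        (auto intro!: derivative_eq_intros P(1)[OF that] simp: Px[OF that])
    then show ?thesis by simp
  qed
  \<comment> \<open>the slope of \<open>P\<close> in \<open>x\<close> is \<open>P (1, y) - P (0, y)\<close>, whose \<open>y\<close>-derivative vanishes\<close>
  define c where "c = 2 * q 1 - q' 1"
  have r: "2 * q y / y - q' y = c" if "y > 0" for y
  proof -
    have "fst (X (1, y)) - fst (X (0, y)) = fst (X (1, 1)) - fst (X (0, 1))"
      by (rule const[OF _ that]) (auto intro!: derivative_eq_intros P(2) simp: Py)
    with Plin[OF that, of 1] Plin[of 1 1] show ?thesis by (simp add: c_def)
  qed
  define e where "e = q 1 - c"
  \<comment> \<open>the linear equation \<open>2 q / y - q' = c\<close> with integrating factor \<open>1 / y\<^sup>2\<close>\<close>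
  have qy: "q y = c * y + e * y\<^sup>2" if "y > 0" for y
  proof -
    have "q y / y\<^sup>2 - c / y = q 1 / 1\<^sup>2 - c / 1"
    proof (rule const[OF _ that])
      fix s :: real assume s: "s > 0"
      have q's: "q' s = 2 * q s / s - c" using r[OF s] by simp
      show "((\<lambda>y. q y / y\<^sup>2 - c / y) has_real_derivative 0) (at s)"
        using s by (auto intro!: derivative_eq_intros q simp: q's field_simps power2_eq_square)
    qed
    with that show ?thesis by (simp add: e_def field_simps power2_eq_square)
  qed
  define f where "f = fst (X (0, 1)) + g * e"
  have P0: "fst (X (0, y)) = f - g * e * y\<^sup>2" if "y > 0" for y
  proof -
    have "fst (X (0, y)) + g * e * y\<^sup>2 = fst (X (0, 1)) + g * e * 1\<^sup>2"
    proof (rule const[OF _ that])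
      fix s :: real assume s: "s > 0"
      have "2 * q s / s = 2 * c + 2 * e * s"
        using s by (simp add: qy add_divide_distrib power2_eq_square)
      with r[OF s] have "q' s = c + 2 * e * s" by simp
      then have "q s / s - q' s = - e * s" using s by (simp add: qy field_simps power2_eq_square)
      then show "((\<lambda>y. fst (X (0, y)) + g * e * y\<^sup>2) has_real_derivative 0) (at s)"
        using s by (auto intro!: derivative_eq_intros P(2) simp: Py)
    qed
    then show ?thesis by (simp add: f_def)
  qed
  have "X = killing_param g (f, c, e)"
  proof
    fix p :: "real \<times> real"
    obtain x y where p: "p = (x, y)" by (cases p)
    show "X p = killing_param g (f, c, e) p"
    proof (cases "p \<in> G")
      case True
      then have y: "y > 0" by (simp add: p G_def)
      show ?thesis
        using True Qx[OF y, of x] qy[OF y] Plin[OF y, of x] r[OF y] P0[OF y]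
        by (simp add: p killing_param_def on_G_def prod_eq_iff)
    qed (simp add: off killing_param_def on_G_def)
  qed
  then show ?thesis by blast
qed

text \<open>
  When the first diagonal coefficient of the form vanishes, the form is a multiple of
  \<open>dy (dx + g dy)\<close>; the multiple drops out of the Killing equation, and it is nonzero because the form is
  nondegenerate.
\<close>

lemma killing_fields_flat:
  assumes A: "det A \<noteq> 0" and flat: "A$2$1 ^ 2 = A$1$1 ^ 2"
    and g: "A$2$2 ^ 2 - A$1$2 ^ 2 = 2 * g * (A$2$1 * A$2$2 - A$1$1 * A$1$2)"
  shows "killing_fields (lorentz_metric A) = range (killing_param g)"
proof -
  define F where "F = A$2$1 * A$2$2 - A$1$1 * A$1$2"
  have "(det A)\<^sup>2 = F\<^sup>2 - (A$2$1 ^ 2 - A$1$1 ^ 2) * (A$2$2 ^ 2 - A$1$2 ^ 2)"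
    by (simp add: F_def det_2 power2_eq_square algebra_simps)
  with A flat have F: "F \<noteq> 0" by auto
  have form: "left_form A v w = F * (fst v * snd w + snd v * fst w + 2 * g * (snd v * snd w))" for v w
    by (simp add: left_form_def flat g F_def algebra_simps)
  show ?thesis
  proof (intro equalityI subsetI)
    fix X assume "X \<in> killing_fields (lorentz_metric A)"
    then have X: "smooth_field X" and
      killing: "\<And>p v w. p \<in> G \<Longrightarrow> left_form A (frechet_derivative X (at p) v) w
        + left_form A v (frechet_derivative X (at p) w) = 2 * (snd (X p) / snd p) * left_form A v w"
      unfolding killing_fields_iff by blast+
    define D where "D p = frechet_derivative X (at p)" for p
    note eq = killing[folded D_def]
    have eq': "fst (D p v) * snd w + snd (D p v) * fst w
      + 2 * g * (snd (D p v) * snd w)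
      + fst v * snd (D p w) + snd v * fst (D p w)
      + 2 * g * (snd v * snd (D p w))
      = 2 * (snd (X p) / snd p) * (fst v * snd w + snd v * fst w + 2 * g * (snd v * snd w))"
      if "p \<in> G" for p v w
    proof -
      have "F * (fst (D p v) * snd w + snd (D p v) * fst w
      + 2 * g * (snd (D p v) * snd w)
      + fst v * snd (D p w) + snd v * fst (D p w)
      + 2 * g * (snd v * snd (D p w)))
      = F * (2 * (snd (X p) / snd p) * (fst v * snd w + snd v * fst w + 2 * g * (snd v * snd w)))"
        using eq[OF that, of v w] unfolding form by (simp only: algebra_simps)
      with F show ?thesis by (simp only: mult_cancel_left) simp
    qed
    show "X \<in> range (killing_param g)"
    proof (rule killing_equation_solution[of X D])
      show "(X has_derivative D p) (at p)" if "p \<in> G" for p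
        unfolding D_def by (rule smooth_has_derivative[OF X that])
      fix p :: "real \<times> real" assume p: "p \<in> G"
      show s: "snd (D p (1, 0)) = 0"
        using eq'[OF p, of "(1,0)" "(1,0)"] by simp
      show "fst (D p (1, 0)) + snd (D p (0, 1))
          = 2 * snd (X p) / snd p"
        using eq'[OF p, of "(1,0)" "(0,1)"] s by simp
      show "fst (D p (0, 1))
          = 2 * g * (snd (X p) / snd p - snd (D p (0, 1)))"
      proof -
        have "2 * (fst (D p (0, 1)) + 2 * g * snd (D p (0, 1)))
            = 2 * (2 * g * (snd (X p) / snd p))"
          using eq'[OF p, of "(0,1)" "(0,1)"] by (simp add: ac_simps)
        then have "fst (D p (0, 1)) + 2 * g * snd (D p (0, 1))
            = 2 * g * (snd (X p) / snd p)"
          by (rule mult_left_cancel[THEN iffD1, rotated]) simp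
        then show ?thesis by (simp add: right_diff_distrib)
      qed
    qed (use X in \<open>auto simp: smooth_field_def\<close>)
  next
    fix X assume "X \<in> range (killing_param g)"
    then obtain f c e where X: "X = killing_param g (f, c, e)" by auto
    show "X \<in> killing_fields (lorentz_metric A)"
      unfolding killing_fields_iff
    proof (intro conjI ballI allI)
      show "smooth_field X" unfolding X by (rule smooth_killing_param)
      fix p v w assume p: "p \<in> G"
      then have y: "snd p \<noteq> 0" by (simp add: G_def)
      show "left_form A (frechet_derivative X (at p) v) w
        + left_form A v (frechet_derivative X (at p) w) = 2 * (snd (X p) / snd p) * left_form A v w"
        unfolding X frechet_derivative_at[OF killing_param_has_derivative[OF p], symmetric] form
        using p y by (simp add: killing_param_def on_G_def case_prod_beta field_simps power2_eq_square)
    qed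
  qed
qed

text \<open>
  Let \<open>A\<close> have rows \<open>(a, b)\<close> and \<open>(c, d)\<close>. Then \<open>c = \<plusminus> a\<close> with \<open>a > 0\<close>, because \<open>a = 0\<close> would force \<open>det A = 0\<close>. The sign of the
  lower left entry \<open>- c / det A\<close> of the inverse tells the two cases apart, which is why \<open>g_const\<close>
  contains a sign.
\<close>

lemma g_const_eq:
  assumes A: "det A > 0" "A$1$1 \<ge> 0" and flat: "A$2$1 ^ 2 = A$1$1 ^ 2"
  shows "A$2$2 ^ 2 - A$1$2 ^ 2 = 2 * g_const A * (A$2$1 * A$2$2 - A$1$1 * A$1$2)"
proof -
  define B :: "real^2^2" where "B = vector [vector [A$2$2 / det A, - A$1$2 / det A],
    vector [- A$2$1 / det A, A$1$1 / det A]]"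
  have D: "A$1$1 * A$2$2 = det A + A$1$2 * A$2$1" by (simp add: det_2)
  have AB: "A ** B = mat 1" and BA: "B ** A = mat 1"
    using A(1) D by (simp_all add: B_def vec_eq_iff forall_2 matrix_matrix_mult_def sum_2 mat_def
        field_simps)
  then have "A ** matrix_inv A = mat 1 \<and> matrix_inv A ** A = mat 1"
    unfolding matrix_inv_def
    using someI[of "\<lambda>X. A ** X = mat 1 \<and> X ** A = mat 1" B] by simp
  then have "B ** (A ** matrix_inv A) = B" by simp
  then have B: "matrix_inv A = B" by (simp add: matrix_mul_assoc BA)
  have a: "A$1$1 > 0"
    using A flat by (cases "A$1$1 = 0") (auto simp: det_2)
  from flat have "A$2$1 = A$1$1 \<or> A$2$1 = - A$1$1" by (simp add: power2_eq_iff)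
  then show ?thesis
    using a A(1) by (auto simp: g_const_def B B_def sgn_if field_simps power2_eq_square)
qed


section \<open>Lie algebras given by structure constants\<close>

lemma lie_algebra_on_range:
  assumes lin: "linear \<Phi>" and alg: "lie_algebra_on UNIV m"
    and br: "\<And>u v. br (\<Phi> u) (\<Phi> v) = \<Phi> (m u v)"
  shows "lie_algebra_on (range \<Phi>) br"
  using alg linear_subspace_image[OF lin subspace_UNIV] linear_0[OF lin]
  unfolding lie_algebra_on_def
  by (auto simp: br linear_add[OF lin, symmetric] linear_scale[OF lin, symmetric])

text \<open>
  The algebra \<open>m\<close> on the parameter space serves as a common model: the isomorphism sends
  \<open>\<Phi> u\<close> to \<open>\<Psi> u\<close>.
\<close>

lemma lie_algebra_isomorphic_range:
  assumes lin: "linear \<Phi>" "inj \<Phi>" "linear \<Psi>" "inj \<Psi>"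
    and alg: "lie_algebra_on UNIV m"
    and br: "\<And>u v. br (\<Phi> u) (\<Phi> v) = \<Phi> (m u v)"
    and br': "\<And>u v. br' (\<Psi> u) (\<Psi> v) = \<Psi> (m u v)"
  shows "lie_algebra_isomorphic (range \<Phi>) br (range \<Psi>) br'"
proof -
  have [simp]: "inv \<Phi> (\<Phi> u) = u" for u by (rule inv_f_f[OF lin(2)])
  have "bij_betw (\<Psi> \<circ> inv \<Phi>) (range \<Phi>) (range \<Psi>)"
    by (rule bij_betwI[where g = "\<Phi> \<circ> inv \<Psi>"]) (auto simp: inv_f_f[OF lin(4)])
  moreover have "inv \<Phi> (\<Phi> u + \<Phi> v) = u + v" "inv \<Phi> (r *\<^sub>R \<Phi> u) = r *\<^sub>R u" for u v r
    by (simp_all add: linear_add[OF lin(1), symmetric] linear_scale[OF lin(1), symmetric])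
  ultimately show ?thesis
    unfolding lie_algebra_isomorphic_def
    using lie_algebra_on_range[of \<Phi> m br] lie_algebra_on_range[of \<Psi> m br'] assms
    by (intro conjI exI[of _ "\<Psi> \<circ> inv \<Phi>"])
      (auto simp: br br' linear_add[OF lin(3)] linear_scale[OF lin(3)])
qed

text \<open>
  The relations \<open>[W, H] = W\<close>, \<open>[Z, H] = - Z\<close>, \<open>[W, Z] = 0\<close> for the basis of
  \<open>\<real>\<^sup>3\<close> named \<open>W, H, Z\<close>: two null translations and a boost.
\<close>

definition param_bracket :: "real \<times> real \<times> real \<Rightarrow> real \<times> real \<times> real \<Rightarrow> real \<times> real \<times> real"
  where "param_bracket = (\<lambda>(f, c, e) (f', c', e'). (f * c' - c * f', 0, c * e' - e * c'))"

lemma lie_algebra_param: "lie_algebra_on UNIV param_bracket"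
  unfolding lie_algebra_on_def param_bracket_def
  by (auto simp: algebra_simps zero_prod_def)

lemma bracket_killing_param:
  "bracket (killing_param g u) (killing_param g v) = killing_param g (param_bracket u v)"
proof
  fix p
  obtain f c e f' c' e' where u: "u = (f, c, e)" "v = (f', c', e')" by (cases u, cases v)
  show "bracket (killing_param g u) (killing_param g v) p = killing_param g (param_bracket u v) p"
  proof (cases "p \<in> G")
    case True
    show ?thesis
      unfolding u bracket_eq[OF True killing_param_has_derivative[OF True] killing_param_has_derivative[OF True]]
      using True by (simp add: killing_param_def on_G_def param_bracket_def case_prod_beta
          power2_eq_square algebra_simps)
  qed (simp add: bracket_def killing_param_def on_G_def case_prod_beta)
qed

text \<open>
  The last coordinate \<open>- 1\<close> of the third generator makes the three parameter vectors a basis.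
\<close>

lemma span_killing_param:
  "span {killing_param g (1, 0, 0), killing_param g (0, 1, 0), killing_param g (- g, 1, - 1)}
    = range (killing_param g)"
proof -
  let ?S = "{(1, 0, 0), (0, 1, 0), (- g, 1, - 1)} :: (real \<times> real \<times> real) set"
  have "u \<in> span ?S" for u
  proof -
    obtain f c e where u: "u = (f, c, e)" by (cases u)
    have "u = (f - g * e) *\<^sub>R (1, 0, 0) + (c + e) *\<^sub>R (0, 1, 0) + (- e) *\<^sub>R (- g, 1, - 1)"
      by (simp add: u)
    also have "\<dots> \<in> span ?S" by (intro span_add span_scale span_base) auto
    finally show ?thesis .
  qed
  then have "span ?S = UNIV" by blast
  then show ?thesis using linear_span_image[OF linear_killing_param[of g], of ?S] by simp
qed


section \<open>The Lie algebra of the group of hyperbolic motions\<close>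

lemma hyp_rotation_add: "hyp_rotation s (hyp_rotation t v) = hyp_rotation (s + t) v"
  by (simp add: hyp_rotation_def vec_eq_iff forall_2 cosh_add sinh_add algebra_simps)

lemma hyp_rotation_zero: "hyp_rotation 0 v = v"
  by (simp add: hyp_rotation_def vec_eq_iff forall_2)

lemma linear_hyp_rotation: "linear (hyp_rotation t)"
  by (rule linearI) (simp_all add: hyp_rotation_def vec_eq_iff forall_2 algebra_simps)

text \<open>
  The maps \<open>v \<mapsto> R v + w\<close> already contain the generators and are closed under composition and
  inversion.
\<close>

lemma SH2_eq: "SH2 = {\<lambda>v. hyp_rotation t v + w | t w. True}"
proof (intro equalityI subsetI)
  fix f assume "f \<in> SH2"
  then have "\<exists>t w. f = (\<lambda>v. hyp_rotation t v + w)"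
  proof induction
    case identity
    show ?case by (rule exI[of _ 0], rule exI[of _ 0]) (simp add: fun_eq_iff hyp_rotation_zero)
  next
    case (translation w)
    show ?case by (rule exI[of _ 0], rule exI[of _ w]) (simp add: fun_eq_iff hyp_rotation_zero)
  next
    case (rotation t)
    show ?case by (rule exI[of _ t], rule exI[of _ 0]) (simp add: fun_eq_iff)
  next
    case (composition f h)
    then obtain s w t z where "f = (\<lambda>v. hyp_rotation s v + w)" "h = (\<lambda>v. hyp_rotation t v + z)"
      by blast
    then show ?case
      by (intro exI[of _ "s + t"] exI[of _ "hyp_rotation s z + w"])
        (simp add: fun_eq_iff linear_add[OF linear_hyp_rotation] hyp_rotation_add add.assoc)
  next
    case (inverse f)
    then obtain t w where f: "f = (\<lambda>v. hyp_rotation t v + w)" by blast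
    have "inv f = (\<lambda>v. hyp_rotation (- t) v + - hyp_rotation (- t) w)"
      by (rule inv_equality)
        (simp_all add: f linear_add[OF linear_hyp_rotation] linear_diff[OF linear_hyp_rotation] hyp_rotation_add hyp_rotation_zero)
    then show ?case by blast
  qed
  then show "f \<in> {\<lambda>v. hyp_rotation t v + w | t w. True}" by blast
next
  fix f assume "f \<in> {\<lambda>v. hyp_rotation t v + w | t w. True}"
  then obtain t w where "f = (\<lambda>v. v + w) \<circ> hyp_rotation t" by (auto simp: comp_def)
  then show "f \<in> SH2" by (simp add: SH2.intros)
qed

definition motion_matrix :: "real \<Rightarrow> real \<Rightarrow> real \<Rightarrow> real^3^3"
  where "motion_matrix t p q = vector [vector [cosh t, sinh t, p], vector [sinh t, cosh t, q],
    vector [0, 0, 1]]"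

lemma affine_matrices_SH2: "affine_matrices SH2 = {motion_matrix t p q | t p q. True}"
proof (intro equalityI subsetI)
  fix M assume "M \<in> affine_matrices SH2"
  then obtain t w where M: "\<And>v. M *v vector [v$1, v$2, 1]
      = vector [(hyp_rotation t v + w) $ 1, (hyp_rotation t v + w) $ 2, 1]"
    unfolding affine_matrices_def SH2_eq by blast
  have "M = motion_matrix t (w$1) (w$2)"
    using M[of "vector [0,0]"] M[of "vector [1,0]"] M[of "vector [0,1]"]
    by (simp add: vec_eq_iff forall_3 matrix_vector_mult_def sum_3 hyp_rotation_def motion_matrix_def)
  then show "M \<in> {motion_matrix t p q | t p q. True}" by blast
next
  fix M assume "M \<in> {motion_matrix t p q | t p q. True}"
  then obtain t p q where M: "M = motion_matrix t p q" by blast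
  define h where "h v = hyp_rotation t v + vector [p, q]" for v
  have "h \<in> SH2" unfolding SH2_eq h_def[abs_def] by blast
  moreover have "M *v vector [v$1, v$2, 1] = vector [h v $ 1, h v $ 2, 1]" for v
    by (simp add: M h_def vec_eq_iff forall_3 matrix_vector_mult_def sum_3 hyp_rotation_def
        motion_matrix_def)
  ultimately show "M \<in> affine_matrices SH2" unfolding affine_matrices_def by blast
qed

text \<open>
  The element \<open>W\<close> corresponds to the translation along the null vector \<open>(1, 1)\<close>, \<open>Z\<close> to the one along
  \<open>(1, - 1)\<close>; these are the eigenvectors of the boost generator for the eigenvalues \<open>1\<close> and \<open>- 1\<close>. The
  sign of \<open>c\<close> compensates for \<open>W\<close> standing on the left in \<open>[W, H] = W\<close>.
\<close>

definition sh2_param :: "real \<times> real \<times> real \<Rightarrow> real^3^3"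
  where "sh2_param = (\<lambda>(f, c, e). vector [vector [0, - c, f + e], vector [- c, 0, f - e],
    vector [0, 0, 0]])"

lemma linear_sh2_param: "linear sh2_param"
  by (rule linearI) (auto simp: sh2_param_def vec_eq_iff forall_3 algebra_simps)

lemma inj_sh2_param: "inj sh2_param"
  by (rule injI) (auto simp: sh2_param_def vec_eq_iff forall_3)

lemma commutator_sh2_param:
  "commutator (sh2_param u) (sh2_param v) = sh2_param (param_bracket u v)"
  by (cases u, cases v) (simp add: commutator_def sh2_param_def param_bracket_def vec_eq_iff forall_3
      matrix_matrix_mult_def sum_3 algebra_simps)

lemma has_vector_derivative_vec_nth:
  fixes f :: "real \<Rightarrow> 'a::real_normed_vector ^ 'n"
  shows "(f has_vector_derivative v) (at s) \<longleftrightarrow>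
    (\<forall>i. ((\<lambda>t. f t $ i) has_vector_derivative v $ i) (at s))"
proof -
  have "(h \<longlongrightarrow> 0) (at s) \<longleftrightarrow> (\<forall>i. ((\<lambda>t. h t $ i) \<longlongrightarrow> 0) (at s))" for h :: "real \<Rightarrow> 'a ^ 'n"
    using vec_tendstoI[of h 0 "at s"] tendsto_vec_nth[of h 0 "at s"] by auto
  then show ?thesis
    by (simp add: has_vector_derivative_def has_derivative_within bounded_linear_scaleR_left)
qed

lemma has_vector_derivative_matrix:
  fixes \<gamma> :: "real \<Rightarrow> real ^ 'n ^ 'm"
  shows "(\<gamma> has_vector_derivative M) (at s) \<longleftrightarrow>
    (\<forall>i j. ((\<lambda>t. \<gamma> t $ i $ j) has_real_derivative M $ i $ j) (at s))"
  by (simp add: has_vector_derivative_vec_nth has_real_derivative_iff_has_vector_derivative)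

text \<open>
  The translation part \<open>(p, q)\<close> of the one-parameter group with rotation speed \<open>k\<close> and initial
  velocity \<open>(a, b)\<close> is the integral of the rotated velocity \<open>R\<^sub>k\<^sub>s (a, b)\<close> over \<open>s\<close>; for
  \<open>k = 0\<close> it is linear.
\<close>

lemma one_parameter_motion:
  "\<exists>p q. (\<forall>s t. motion_matrix (k * (s + t)) (p (s + t)) (q (s + t))
      = motion_matrix (k * s) (p s) (q s) ** motion_matrix (k * t) (p t) (q t))
    \<and> p 0 = 0 \<and> q 0 = 0
    \<and> (p has_real_derivative a) (at 0) \<and> (q has_real_derivative b) (at 0)"
proof (cases "k = 0")
  case True
  show ?thesis
    by (rule exI[of _ "\<lambda>s. a * s"], rule exI[of _ "\<lambda>s. b * s"])
      (auto simp: True motion_matrix_def vec_eq_iff forall_3 matrix_matrix_mult_def sum_3 algebra_simps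
        intro!: derivative_eq_intros)
next
  case False
  define p where "p s = (sinh (k * s) * a + (cosh (k * s) - 1) * b) / k" for s
  define q where "q s = ((cosh (k * s) - 1) * a + sinh (k * s) * b) / k" for s
  have "p (s + t) = cosh (k * s) * p t + sinh (k * s) * q t + p s"
    "q (s + t) = sinh (k * s) * p t + cosh (k * s) * q t + q s" for s t
    using False by (simp_all add: p_def q_def distrib_left sinh_add cosh_add field_simps)
  then have "motion_matrix (k * (s + t)) (p (s + t)) (q (s + t))
      = motion_matrix (k * s) (p s) (q s) ** motion_matrix (k * t) (p t) (q t)" for s t
    by (simp add: motion_matrix_def vec_eq_iff forall_3 matrix_matrix_mult_def sum_3
        distrib_left sinh_add cosh_add)
  moreover have "(p has_real_derivative a) (at 0)" "(q has_real_derivative b) (at 0)"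
    unfolding p_def q_def using False by (auto intro!: derivative_eq_intros)
  moreover have "p 0 = 0" "q 0 = 0" by (simp_all add: p_def q_def)
  ultimately show ?thesis by blast
qed

text \<open>
  For the inclusion from left to right the derivative at \<open>0\<close> of the equations that cut out the motion
  matrices suffices; in particular \<open>cosh\<^sup>2 - sinh\<^sup>2 = 1\<close> forces the diagonal of the velocity to vanish. The
  other inclusion needs the one-parameter group with a prescribed velocity.
\<close>

lemma sh2_eq: "sh2 = range sh2_param"
proof (intro equalityI subsetI)
  fix M assume "M \<in> sh2"
  then obtain \<gamma> where \<gamma>: "range \<gamma> \<subseteq> affine_matrices SH2" "\<gamma> 0 = mat 1"
    "(\<gamma> has_vector_derivative M) (at 0)"
    unfolding sh2_def lie_algebra_of_def by blast
  have ent: "\<gamma> s $ 2 $ 2 = \<gamma> s $ 1 $ 1" "\<gamma> s $ 2 $ 1 = \<gamma> s $ 1 $ 2"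
    "\<gamma> s $ 3 $ 1 = 0" "\<gamma> s $ 3 $ 2 = 0" "\<gamma> s $ 3 $ 3 = 1"
    "(\<gamma> s $ 1 $ 1)\<^sup>2 - (\<gamma> s $ 1 $ 2)\<^sup>2 = 1" for s
  proof -
    obtain t p q where "\<gamma> s = motion_matrix t p q"
      using \<gamma>(1) unfolding affine_matrices_SH2 by blast
    then show "\<gamma> s $ 2 $ 2 = \<gamma> s $ 1 $ 1" "\<gamma> s $ 2 $ 1 = \<gamma> s $ 1 $ 2"
      "\<gamma> s $ 3 $ 1 = 0" "\<gamma> s $ 3 $ 2 = 0" "\<gamma> s $ 3 $ 3 = 1"
      "(\<gamma> s $ 1 $ 1)\<^sup>2 - (\<gamma> s $ 1 $ 2)\<^sup>2 = 1"
      by (simp_all add: motion_matrix_def cosh_square_eq)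
  qed
  have d: "((\<lambda>t. \<gamma> t $ i $ j) has_real_derivative M $ i $ j) (at 0)" for i j
    using \<gamma>(3) by (simp add: has_vector_derivative_matrix)
  have z: "x = 0" if "((\<lambda>t. c) has_real_derivative x) (at 0)" for x c :: real
    using DERIV_unique[OF that DERIV_const] .
  have "M$3$1 = 0" "M$3$2 = 0" "M$3$3 = 0"
    using z[OF d[of 3 1, unfolded ent]] z[OF d[of 3 2, unfolded ent]] z[OF d[of 3 3, unfolded ent]]
    by this+
  moreover have "M$2$2 = M$1$1" "M$2$1 = M$1$2"
    using DERIV_unique[OF d[of 2 2, unfolded ent] d[of 1 1]]
      DERIV_unique[OF d[of 2 1, unfolded ent] d[of 1 2]] by this+
  moreover have "M$1$1 = 0"
  proof -
    have "((\<lambda>t. (\<gamma> t $ 1 $ 1)\<^sup>2 - (\<gamma> t $ 1 $ 2)\<^sup>2) has_real_derivative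
        2 * \<gamma> 0 $ 1 $ 1 * M$1$1 - 2 * \<gamma> 0 $ 1 $ 2 * M$1$2) (at 0)"
      by (rule derivative_eq_intros d refl)+ simp
    from z[OF this[unfolded ent]] show ?thesis by (simp add: \<gamma>(2) mat_def)
  qed
  ultimately have "M = sh2_param ((M$1$3 + M$2$3) / 2, - (M$1$2), (M$1$3 - M$2$3) / 2)"
    by (simp add: sh2_param_def vec_eq_iff forall_3 field_simps)
  then show "M \<in> range sh2_param" by blast
next
  fix M assume "M \<in> range sh2_param"
  then obtain f c e where M: "M = sh2_param (f, c, e)" by auto
  obtain p q where pq: "\<And>s t. motion_matrix (- c * (s + t)) (p (s + t)) (q (s + t))
      = motion_matrix (- c * s) (p s) (q s) ** motion_matrix (- c * t) (p t) (q t)"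
    "p 0 = 0" "q 0 = 0"
    "(p has_real_derivative f + e) (at 0)" "(q has_real_derivative f - e) (at 0)"
    using one_parameter_motion[of "- c" "f + e" "f - e"] by blast
  define \<gamma> where "\<gamma> s = motion_matrix (- c * s) (p s) (q s)" for s
  have "range \<gamma> \<subseteq> affine_matrices SH2"
    unfolding affine_matrices_SH2 \<gamma>_def by blast
  moreover have "\<gamma> 0 = mat 1"
    by (simp add: \<gamma>_def pq(2,3) motion_matrix_def vec_eq_iff forall_3 mat_def)
  moreover have "\<forall>s t. \<gamma> (s + t) = \<gamma> s ** \<gamma> t" unfolding \<gamma>_def using pq(1) by blast
  moreover have "((\<lambda>s. cosh (- c * s)) has_real_derivative 0) (at 0)"
    "((\<lambda>s. sinh (- c * s)) has_real_derivative - c) (at 0)"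
    by (auto intro!: derivative_eq_intros)
  then have "(\<gamma> has_vector_derivative M) (at 0)"
    unfolding has_vector_derivative_matrix forall_3
    using pq(4,5) by (simp add: M \<gamma>_def[abs_def] motion_matrix_def sh2_param_def)
  ultimately show "M \<in> sh2" unfolding sh2_def lie_algebra_of_def by blast
qed


section \<open>The flat left-invariant Lorentzian structures\<close>

theorem theorem19:
  fixes A :: "real ^ 2 ^ 2"
  assumes "det A > 0"
    and "A $ 1 $ 1 \<ge> 0"
    and "\<forall>p\<in>G. sectional_curvature (lorentz_metric A) p = 0"
  shows "killing_fields (lorentz_metric A) = span {Xt1, Xt2, X0 A} \<and>
    bracket Xt1 Xt2 = Xt1 \<and>
    bracket Xt1 (X0 A) = Xt1 \<and>
    bracket Xt2 (X0 A) = (2 * g_const A) *\<^sub>R Xt1 - Xt2 + X0 A \<and>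
    lie_algebra_isomorphic (killing_fields (lorentz_metric A)) bracket sh2 commutator"
proof -
  define \<Phi> where "\<Phi> = killing_param (g_const A)"
  have gens: "Xt1 = \<Phi> (1, 0, 0)" "Xt2 = \<Phi> (0, 1, 0)" "X0 A = \<Phi> (- g_const A, 1, - 1)"
    by (auto simp: \<Phi>_def killing_param_def Xt1_def Xt2_def X0_def on_G_def fun_eq_iff
        power2_eq_square algebra_simps)
  have lin: "linear \<Phi>" unfolding \<Phi>_def by (rule linear_killing_param)
  have br: "bracket (\<Phi> u) (\<Phi> v) = \<Phi> (param_bracket u v)" for u v
    unfolding \<Phi>_def by (rule bracket_killing_param)
  have "(0, 1) \<in> G" by (simp add: G_def)
  with assms have flat: "A$2$1 ^ 2 = A$1$1 ^ 2"
    using sectional_curvature_eq[of A "(0, 1)"] by simp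
  have K: "killing_fields (lorentz_metric A) = range \<Phi>"
    unfolding \<Phi>_def
    by (rule killing_fields_flat) (use assms flat g_const_eq in auto)
  have "bracket Xt2 (X0 A) = \<Phi> ((2 * g_const A) *\<^sub>R (1, 0, 0) - (0, 1, 0) + (- g_const A, 1, - 1))"
    by (simp add: gens br param_bracket_def)
  also have "\<dots> = (2 * g_const A) *\<^sub>R Xt1 - Xt2 + X0 A"
    by (simp only: gens linear_add[OF lin] linear_diff[OF lin] linear_scale[OF lin])
  finally have "bracket Xt2 (X0 A) = (2 * g_const A) *\<^sub>R Xt1 - Xt2 + X0 A" .
  moreover have "bracket Xt1 Xt2 = Xt1" "bracket Xt1 (X0 A) = Xt1"
    by (simp_all add: gens br param_bracket_def)
  moreover have "range \<Phi> = span {Xt1, Xt2, X0 A}"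
    using span_killing_param[of "g_const A"] by (simp add: gens \<Phi>_def)
  moreover have "lie_algebra_isomorphic (range \<Phi>) bracket sh2 commutator"
    unfolding sh2_eq
  proof (rule lie_algebra_isomorphic_range[where m = param_bracket])
    show "inj \<Phi>" unfolding \<Phi>_def by (rule inj_killing_param)
  qed (rule lin br linear_sh2_param inj_sh2_param lie_algebra_param commutator_sh2_param)+
  ultimately show ?thesis by (simp add: K)
qed

end
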